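(* Let $n\ge 2$, let $\mu\in\mathbb{R}^n$, let $\Sigma$ be a symmetric positive definite real $n\times n$ matrix, and let $\delta=(\delta_1,\dots,\delta_n)\in\mathbb{R}^n$, $\delta\neq 0$. Let $g:[0,\infty)\to[0,\infty)$ be continuous and nowhere $0$, with $s\mapsto g(s^2)$ integrable over $\mathbb{R}$, and suppose that the random vector $X=(X_1,\dots,X_n)$ has probability density $$f_X(x)=|\Sigma|^{-1/2}\,g\big((x-\mu)\Sigma^{-1}(x-\mu)^t\big),\qquad x\in\mathbb{R}^n .$$ Let $\Delta\Pi=\delta_1X_1+\cdots+\delta_nX_n$ and let $0<\alpha<1$. Then the Value-at-Risk $VaR_\alpha$ of $\Delta\Pi$ at confidence $1-\alpha$ is given by $$VaR_\alpha=-\delta\cdot\mu+q_{\alpha,n}^{g}\cdot\sqrt{\delta\Sigma\delta^t},$$ where $q_{\alpha,n}^{g}$ is the unique real solution $s$ of the equation $\alpha=G(s)$, with $$G(s)=\frac{2\pi^{\frac{n-1}{2}}}{\Gamma\left(\frac{n-1}{2}\right)}\int_{-\infty}^{-s}\left[\int_0^{\infty}r^{n-2}\,g(z_1^2+r^2)\,dr\right]dz_1 .$$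
   Context: Vectors $x\in\mathbb{R}^n$ are row vectors, $x^t$ is the transpose (column vector), $x\cdot y=xy^t$ is the Euclidean inner product, and $|\Sigma|$ is the determinant of $\Sigma$. $\Gamma$ is the Gamma function. The Value-at-Risk at confidence $1-\alpha$ of a portfolio with profit and loss $\Delta\Pi$ is the number $VaR_\alpha$ solving $\mathrm{Prob}\{\Delta\Pi<-VaR_\alpha\}=\alpha$. The vector $\mu$ and matrix $\Sigma$ are the location and dispersion parameters of the elliptic distribution, as they appear in the density. *)

theory Defs
  imports "HOL-Probability.Probability"
begin

definition symmetric_matrix :: "real^'n^'n \<Rightarrow> bool" where
  "symmetric_matrix S \<longleftrightarrow> transpose S = S"

definition positive_definite :: "real^'n^'n \<Rightarrow> bool" where
  "positive_definite S \<longleftrightarrow> (\<forall>x. x \<noteq> 0 \<longrightarrow> (x v* S) \<bullet> x > 0)"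

text \<open>Vectors are row vectors, so \<open>x S y\<^sup>t\<close> is rendered as \<open>(x v* S) \<bullet> y\<close>.\<close>

definition elliptic_density ::
    "(real \<Rightarrow> real) \<Rightarrow> real^'n \<Rightarrow> real^'n^'n \<Rightarrow> real^'n \<Rightarrow> real" where
  "elliptic_density g \<mu> S x =
     det S powr (-1/2) * g (((x - \<mu>) v* matrix_inv S) \<bullet> (x - \<mu>))"

text \<open>The argument \<open>\<alpha>\<close> is the tail probability, i.e. the confidence level is \<open>1 - \<alpha>\<close>.\<close>

definition is_value_at_risk :: "'a measure \<Rightarrow> ('a \<Rightarrow> real) \<Rightarrow> real \<Rightarrow> real \<Rightarrow> bool" where
  "is_value_at_risk M P \<alpha> v \<longleftrightarrow> measure M {\<omega> \<in> space M. P \<omega> < - v} = \<alpha>"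

definition value_at_risk :: "'a measure \<Rightarrow> ('a \<Rightarrow> real) \<Rightarrow> real \<Rightarrow> real" where
  "value_at_risk M P \<alpha> = (THE v. is_value_at_risk M P \<alpha> v)"

text \<open>Only meaningful for \<open>n \<ge> 2\<close>, where the subtraction in \<open>r ^ (n - 2)\<close> does not truncate.\<close>

definition tail_function :: "(real \<Rightarrow> real) \<Rightarrow> nat \<Rightarrow> real \<Rightarrow> real" where
  "tail_function g n s =
     2 * pi powr ((real n - 1) / 2) / Gamma ((real n - 1) / 2) *
     (LBINT z:{..-s}. (LBINT r:{0..}. r ^ (n - 2) * g (z\<^sup>2 + r\<^sup>2)))"

definition elliptic_quantile :: "real \<Rightarrow> nat \<Rightarrow> (real \<Rightarrow> real) \<Rightarrow> real" where
  "elliptic_quantile \<alpha> n g = (THE s. \<alpha> = tail_function g n s)"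

end

theory Submission
  imports Defs
begin

text \<open>
  The idea is to replace the portfolio by a single coordinate of a rotationally symmetric vector.
  Since \<open>S\<close> is symmetric and positive definite, so is its inverse, and Gram-Schmidt for the form
  \<open>x S\<^sup>-\<^sup>1 y\<^sup>t\<close> gives an orthonormal basis that starts with the normalized vector \<open>\<delta> S\<close>. The remaining
  basis vectors are then orthogonal to \<open>\<delta>\<close> in the Euclidean sense. Writing \<open>X = \<mu> + Y A\<close>, where the
  rows of \<open>A\<close> are this basis, turns the quadratic form of the density into \<open>\<bar>y\<bar>\<^sup>2\<close> and the profit and
  loss into \<open>\<delta> \<bullet> \<mu> + \<sigma> Y\<^sub>k\<close> with \<open>\<sigma>\<^sup>2 = \<delta> S \<delta>\<^sup>t\<close> (lemma \<open>elliptic_standardizing_matrix\<close>). The Jacobian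
  \<open>\<bar>det A\<bar>\<close> cancels the factor \<open>(det S)\<^sup>-\<^sup>1\<^sup>/\<^sup>2\<close> of the density, so that \<open>Y\<close> has density \<open>g(\<bar>y\<bar>\<^sup>2)\<close>.

  Fixing the coordinate \<open>z = y\<^sub>k\<close> and passing to polar coordinates in the \<open>n - 1\<close> others gives the
  density of \<open>Y\<^sub>k\<close>, namely the inner integral of \<open>G\<close> times the area of the unit sphere
  (lemmas \<open>nn_integral_coordinate_norm\<close> and \<open>distr_standardized_portfolio\<close>). Hence \<open>G(s)\<close> is the
  distribution function of \<open>Y\<^sub>k\<close> at \<open>-s\<close> (lemma \<open>tail_function_eq_cdf\<close>). A distribution function with
  an everywhere positive density is continuous and strictly increasing from \<open>0\<close> to \<open>1\<close>
  (lemma \<open>positive_density_unique_quantile\<close>). So it takes the value \<open>\<alpha>\<close> at exactly one \<open>x\<close>, the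
  quantile is \<open>-x\<close>, and undoing the affine substitution gives the Value-at-Risk.
\<close>

section \<open>Bases that are orthonormal for a quadratic form\<close>

text \<open>
  A row vector \<open>x\<close> in the kernel of \<open>S\<close> would have \<open>x S x\<^sup>t = 0\<close>.
\<close>
lemma positive_definite_det_nonzero:
  fixes S :: "real^'n^'n"
  assumes "positive_definite S"
  shows "det S \<noteq> 0"
proof
  assume "det S = 0"
  then have "\<not> invertible (transpose S)" by (simp add: invertible_det_nz)
  then obtain x where "transpose S *v x = 0" "x \<noteq> 0"
    unfolding invertible_left_inverse matrix_left_invertible_ker by blast
  then show False
    using assms unfolding positive_definite_def by fastforce
qed

text \<open>
  Positivity is transported by \<open>x = y S\<close>, which gives \<open>x S\<^sup>-\<^sup>1 x\<^sup>t = y S y\<^sup>t\<close>.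
\<close>
lemma inverse_of_positive_definite:
  fixes S :: "real^'n^'n"
  assumes sym: "symmetric_matrix S" and pos: "positive_definite S"
  shows "S ** matrix_inv S = mat 1" "matrix_inv S ** S = mat 1"
    and "symmetric_matrix (matrix_inv S)" "positive_definite (matrix_inv S)"
proof -
  have inv: "invertible S"
    using positive_definite_det_nonzero[OF pos] by (simp add: invertible_det_nz)
  show 1: "S ** matrix_inv S = mat 1" and 2: "matrix_inv S ** S = mat 1"
    using someI_ex[OF inv[unfolded invertible_def]] by (simp_all add: matrix_inv_def)
  have t: "S ** transpose (matrix_inv S) = mat 1"
    using arg_cong[OF 2, of transpose] sym
    by (simp add: matrix_transpose_mul symmetric_matrix_def)
  have "transpose (matrix_inv S) = matrix_inv S ** (S ** transpose (matrix_inv S))"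
    by (simp add: matrix_mul_assoc 2)
  also have "\<dots> = matrix_inv S"
    by (simp add: t)
  finally show sym': "symmetric_matrix (matrix_inv S)"
    by (simp add: symmetric_matrix_def)
  show "positive_definite (matrix_inv S)"
    unfolding positive_definite_def
  proof (intro allI impI)
    fix x :: "real^'n" assume "x \<noteq> 0"
    define y where "y = x v* matrix_inv S"
    have x: "x = y v* S"
      by (simp add: y_def vector_matrix_mul_assoc 2)
    then have "y \<noteq> 0" using \<open>x \<noteq> 0\<close> by auto
    then have "0 < (y v* S) \<bullet> y" using pos by (simp add: positive_definite_def)
    then show "0 < (x v* matrix_inv S) \<bullet> x"
      by (simp add: x[symmetric] y_def[symmetric] inner_commute)
  qed
qed

lemma symmetric_form_commute:
  fixes Q :: "real^'n^'n"
  assumes "symmetric_matrix Q"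
  shows "(x v* Q) \<bullet> y = (y v* Q) \<bullet> x"
proof -
  have "(x v* Q) \<bullet> y = x \<bullet> (transpose Q *v y)"
    using assms by (simp add: dot_lmul_matrix symmetric_matrix_def)
  then show ?thesis by (simp add: inner_commute)
qed

text \<open>
  Gram-Schmidt without explicit projections. The vectors orthogonal to the family built so far for
  the form \<open>Q\<close> are those orthogonal in the Euclidean sense to the vectors \<open>b\<^sub>i Q\<close>. As long as there are
  fewer than \<open>n\<close> of these, they do not span the space, so a nonzero orthogonal vector remains, and
  positive definiteness allows it to be normalized.
\<close>
lemma orthonormal_family_extending:
  fixes Q :: "real^'n^'n" and u :: "real^'n" and k :: 'n
  assumes sym: "symmetric_matrix Q" and pos: "positive_definite Q"
    and unit: "(u v* Q) \<bullet> u = 1"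
  obtains b :: "'n \<Rightarrow> real^'n" where "b k = u"
    and "\<And>i j. (b i v* Q) \<bullet> b j = (if i = j then 1 else 0)"
proof -
  have "\<exists>b :: 'n \<Rightarrow> real^'n. b k = u \<and>
      (\<forall>i\<in>insert k I. \<forall>j\<in>insert k I. (b i v* Q) \<bullet> b j = (if i = j then 1 else 0))"
    if "finite I" for I
    using that
  proof (induction I)
    case empty
    then show ?case by (intro exI[of _ "\<lambda>_. u"]) (simp add: unit)
  next
    case (insert l I)
    then obtain b :: "'n \<Rightarrow> real^'n" where "b k = u"
      and "\<forall>i\<in>insert k I. \<forall>j\<in>insert k I. (b i v* Q) \<bullet> b j = (if i = j then 1 else 0)"
      by (elim exE conjE) (rule that)
    then have b: "b k = u"
      "\<And>i j. i \<in> insert k I \<Longrightarrow> j \<in> insert k I \<Longrightarrow> (b i v* Q) \<bullet> b j = (if i = j then 1 else 0)"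
      by blast+
    show ?case
    proof (cases "l = k")
      case True
      then show ?thesis using b by (intro exI[of _ b]) simp
    next
      case False
      let ?V = "(\<lambda>i. b i v* Q) ` insert k I"
      have "dim ?V \<le> card ?V"
        using insert.hyps by (intro dim_le_card') auto
      also have "\<dots> \<le> card (insert k I)"
        using insert.hyps by (intro card_image_le) auto
      also have "\<dots> < DIM(real^'n)"
        using insert.hyps False
        by (auto intro!: psubset_card_mono)
      finally obtain x where x: "x \<noteq> 0" and orth: "\<And>y. y \<in> span ?V \<Longrightarrow> orthogonal x y"
        using orthogonal_to_subspace_exists by blast
      have orth: "(b i v* Q) \<bullet> x = 0" if "i \<in> insert k I" for i
        using orth[of "b i v* Q"] that
        by (auto simp: orthogonal_def inner_commute intro: span_base)
      define c where "c = (x v* Q) \<bullet> x"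
      have "c > 0" using pos x by (simp add: c_def positive_definite_def)
      define w where "w = (1 / sqrt c) *\<^sub>R x"
      have ww: "(w v* Q) \<bullet> w = 1"
        using \<open>c > 0\<close> by (simp add: w_def scaleR_vector_matrix_assoc flip: c_def)
      have bw: "(b i v* Q) \<bullet> w = 0" "(w v* Q) \<bullet> b i = 0" if "i \<in> insert k I" for i
        using orth[OF that] symmetric_form_commute[OF sym, of w "b i"] by (simp_all add: w_def)
      show ?thesis
        using b ww bw False insert.hyps
        by (intro exI[of _ "b(l := w)"]) auto
    qed
  qed
  from this[of UNIV] show ?thesis
    using that by auto
qed

text \<open>
  The first basis vector \<open>u = \<delta> S / \<sigma>\<close> is chosen because \<open>u S\<^sup>-\<^sup>1 = \<delta> / \<sigma>\<close>: the Euclidean product with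
  \<open>\<delta>\<close> is then \<open>\<sigma>\<close> times the product with \<open>u\<close> for the form \<open>S\<^sup>-\<^sup>1\<close>, and it vanishes on all other basis
  vectors. Orthonormality says \<open>A S\<^sup>-\<^sup>1 A\<^sup>t = 1\<close>, which also determines the determinant of \<open>A\<close> up to
  sign.
\<close>
lemma elliptic_standardizing_matrix:
  fixes S :: "real^'n^'n" and \<delta> :: "real^'n" and k :: 'n
  assumes sym: "symmetric_matrix S" and pos: "positive_definite S" and "\<delta> \<noteq> 0"
  obtains A :: "real^'n^'n"
  where "\<And>y. ((y v* A) v* matrix_inv S) \<bullet> (y v* A) = y \<bullet> y"
    and "\<And>y. \<delta> \<bullet> (y v* A) = sqrt ((\<delta> v* S) \<bullet> \<delta>) * y $ k"
    and "det A ^ 2 = det S" "det A \<noteq> 0"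
proof -
  define \<sigma> where "\<sigma> = sqrt ((\<delta> v* S) \<bullet> \<delta>)"
  have q: "(\<delta> v* S) \<bullet> \<delta> > 0" using pos \<open>\<delta> \<noteq> 0\<close> by (simp add: positive_definite_def)
  have \<sigma>: "\<sigma> > 0" "\<sigma>\<^sup>2 = (\<delta> v* S) \<bullet> \<delta>" using q by (simp_all add: \<sigma>_def)
  note Q = inverse_of_positive_definite[OF sym pos]
  define u where "u = (1 / \<sigma>) *\<^sub>R (\<delta> v* S)"
  have uQ: "u v* matrix_inv S = (1 / \<sigma>) *\<^sub>R \<delta>"
    by (simp add: u_def scaleR_vector_matrix_assoc vector_matrix_mul_assoc Q(1))
  have "(u v* matrix_inv S) \<bullet> u = 1"
    unfolding uQ using \<sigma> q by (simp add: u_def inner_commute power2_eq_square)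
  then obtain b :: "'n \<Rightarrow> real^'n" where bk: "b k = u"
    and b: "\<And>i j. (b i v* matrix_inv S) \<bullet> b j = (if i = j then 1 else 0)"
    using orthonormal_family_extending[OF Q(3,4)] by blast
  define A :: "real^'n^'n" where "A = (\<chi> i. b i)"
  have yA: "y v* A = (\<Sum>i\<in>UNIV. y $ i *\<^sub>R b i)" for y
    by (simp add: vec_eq_iff vector_matrix_mult_def A_def)
  have AQA: "A ** matrix_inv S ** transpose A = mat 1"
  proof -
    have "(A ** matrix_inv S ** transpose A) $ i $ j = (b i v* matrix_inv S) \<bullet> b j" for i j
      by (simp add: matrix_matrix_mult_def transpose_def A_def vector_matrix_mult_def inner_vec_def)
    then show ?thesis by (simp add: vec_eq_iff b mat_def)
  qed
  have dAQ: "det A * det (matrix_inv S) * det A = 1"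
    using arg_cong[OF AQA, of det] by (simp add: det_mul)
  have dSQ: "det S * det (matrix_inv S) = 1"
    using arg_cong[OF Q(1), of det] by (simp add: det_mul)
  show ?thesis
  proof (rule that[of A])
    fix y :: "real^'n"
    have "((y v* A) v* matrix_inv S) \<bullet> (y v* A) = (y v* (A ** matrix_inv S ** transpose A)) \<bullet> y"
      by (simp add: vector_matrix_mul_assoc[symmetric] inner_commute dot_lmul_matrix)
    then show "((y v* A) v* matrix_inv S) \<bullet> (y v* A) = y \<bullet> y"
      by (simp add: AQA)
    have "\<delta> \<bullet> b i = (if i = k then \<sigma> else 0)" for i
    proof -
      have "\<delta> \<bullet> b i = \<sigma> * ((b k v* matrix_inv S) \<bullet> b i)"
        using \<sigma> by (simp add: bk uQ)
      then show ?thesis by (simp add: b)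
    qed
    then show "\<delta> \<bullet> (y v* A) = sqrt ((\<delta> v* S) \<bullet> \<delta>) * y $ k"
      by (simp add: yA inner_sum_right if_distrib[of "\<lambda>x. _ * x"] cong: if_cong flip: \<sigma>_def)
  next
    show "det A ^ 2 = det S"
    proof -
      have "det A ^ 2 = det A ^ 2 * (det S * det (matrix_inv S))" by (simp add: dSQ)
      also have "\<dots> = (det A * det (matrix_inv S) * det A) * det S"
        by (simp add: power2_eq_square mult_ac)
      finally show ?thesis by (simp add: dAQ)
    qed
    show "det A \<noteq> 0" using dAQ by auto
  qed
qed

section \<open>Affine changes of variables\<close>

text \<open>
  An invertible linear map is a composition of coordinate scalings, swaps of two coordinates and
  shears. Each of these is treated separately, without an order on the finite index type.
\<close>

lemma borel_measurable_linear:
  fixes f :: "'a::euclidean_space \<Rightarrow> 'b::euclidean_space"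
  assumes "linear f"
  shows "f \<in> borel_measurable borel"
  using assms
  by (simp add: borel_measurable_continuous_onI linear_continuous_on linear_conv_bounded_linear)

text \<open>
  Integrating over the coordinate \<open>y \<bullet> e\<close> first, the other coordinates being fixed, the shear is a
  translation of that coordinate by a constant.
\<close>
lemma nn_integral_shear:
  fixes F :: "'a::euclidean_space \<Rightarrow> ennreal"
  assumes F[measurable]: "F \<in> borel_measurable borel"
    and e: "e \<in> Basis" "e' \<in> Basis" "e \<noteq> e'"
  shows "(\<integral>\<^sup>+y. F (y + (y \<bullet> e') *\<^sub>R e) \<partial>lborel) = (\<integral>\<^sup>+y. F y \<partial>lborel)"
proof -
  interpret product_sigma_finite "\<lambda>_::'a. lborel :: real measure" by standard
  define B where "B = Basis - {e}"
  have B: "finite B" "e \<notin> B" "Basis = insert e B" using e by (auto simp: B_def)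
  define v where "v x = (\<Sum>b\<in>B. x b *\<^sub>R b)" for x :: "'a \<Rightarrow> real"
  have v: "(\<Sum>b\<in>Basis. (x(e := y)) b *\<^sub>R b) = y *\<^sub>R e + v x" for x y
  proof -
    have "(\<Sum>b\<in>B. (x(e := y)) b *\<^sub>R b) = v x"
      unfolding v_def using B(2) by (intro sum.cong) auto
    then show ?thesis unfolding B(3) using B(1,2) by (subst sum.insert) auto
  qed
  have coord: "(\<Sum>b\<in>Basis. x b *\<^sub>R b) \<bullet> e' = x e'" for x
    using e by (simp add: inner_sum_left_Basis)
  have split: "(\<integral>\<^sup>+y. G y \<partial>lborel) = (\<integral>\<^sup>+x. \<integral>\<^sup>+y. G (y *\<^sub>R e + v x) \<partial>lborel \<partial>Pi\<^sub>M B (\<lambda>_. lborel))"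
    if [measurable]: "G \<in> borel_measurable borel" for G :: "'a \<Rightarrow> ennreal"
  proof -
    have "(\<integral>\<^sup>+y. G y \<partial>lborel) = (\<integral>\<^sup>+x. G (\<Sum>b\<in>Basis. x b *\<^sub>R b) \<partial>Pi\<^sub>M Basis (\<lambda>_. lborel))"
      by (subst lborel_eq, subst nn_integral_distr) simp_all
    also have "\<dots> = (\<integral>\<^sup>+x. G (\<Sum>b\<in>Basis. x b *\<^sub>R b) \<partial>Pi\<^sub>M (insert e B) (\<lambda>_. lborel))"
      by (simp only: B(3)[symmetric])
    also have "\<dots> = (\<integral>\<^sup>+x. \<integral>\<^sup>+y. G (\<Sum>b\<in>Basis. (x(e := y)) b *\<^sub>R b) \<partial>lborel \<partial>Pi\<^sub>M B (\<lambda>_. lborel))"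
      by (rule product_nn_integral_insert[OF B(1,2)]) (simp add: B(3)[symmetric])
    finally show ?thesis by (simp only: v)
  qed
  have ve: "(y *\<^sub>R e + v x) \<bullet> e' = x e'" for x y
    using coord[of "x(e := y)"] e(3) unfolding v by simp
  have "(\<integral>\<^sup>+y. F (y + (y \<bullet> e') *\<^sub>R e) \<partial>lborel)
      = (\<integral>\<^sup>+x. \<integral>\<^sup>+y. F ((y *\<^sub>R e + v x) + x e' *\<^sub>R e) \<partial>lborel \<partial>Pi\<^sub>M B (\<lambda>_. lborel))"
    by (subst split) (simp_all add: ve)
  also have "\<dots> = (\<integral>\<^sup>+x. \<integral>\<^sup>+y. F ((x e' + 1 * y) *\<^sub>R e + v x) \<partial>lborel \<partial>Pi\<^sub>M B (\<lambda>_. lborel))"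
    by (simp add: scaleR_add_left add_ac)
  also have "\<dots> = (\<integral>\<^sup>+x. \<integral>\<^sup>+y. F (y *\<^sub>R e + v x) \<partial>lborel \<partial>Pi\<^sub>M B (\<lambda>_. lborel))"
  proof (rule nn_integral_cong)
    fix x
    show "(\<integral>\<^sup>+y. F ((x e' + 1 * y) *\<^sub>R e + v x) \<partial>lborel) = (\<integral>\<^sup>+y. F (y *\<^sub>R e + v x) \<partial>lborel)"
      using nn_integral_real_affine[of "\<lambda>y. F (y *\<^sub>R e + v x)" 1 "x e'"] by simp
  qed
  also have "\<dots> = (\<integral>\<^sup>+y. F y \<partial>lborel)"
    by (subst split) simp_all
  finally show ?thesis .
qed

lemma Basis_vec_range: "(Basis :: (real^'n) set) = range (\<lambda>i. axis i 1)"
  by (auto simp: Basis_vec_def)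

lemma prod_Basis_vec: "(\<Prod>b\<in>(Basis :: (real^'n) set). h b) = (\<Prod>i\<in>UNIV. h (axis i 1))"
  unfolding Basis_vec_range by (subst prod.reindex) (auto simp: inj_on_def axis_eq_axis)

text \<open>
  An involution of the coordinates maps a box to a box whose side lengths are permuted, and boxes
  determine Lebesgue measure.
\<close>
lemma nn_integral_permute_coordinates:
  fixes F :: "real^'n \<Rightarrow> ennreal" and \<tau> :: "'n \<Rightarrow> 'n"
  assumes F[measurable]: "F \<in> borel_measurable borel" and \<tau>: "\<tau> permutes UNIV" "\<And>i. \<tau> (\<tau> i) = i"
  shows "(\<integral>\<^sup>+x. F (\<chi> i. x $ \<tau> i) \<partial>lborel) = (\<integral>\<^sup>+x. F x \<partial>lborel)"
proof -
  define p where "p x = (\<chi> i. x $ \<tau> i)" for x :: "real^'n"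
  have "linear p" unfolding p_def by (rule linearI) (simp_all add: vec_eq_iff)
  then have [measurable]: "p \<in> borel_measurable borel" by (rule borel_measurable_linear)
  have "lborel = distr lborel borel p"
  proof (rule lborel_eqI)
    fix l u :: "real^'n" assume lu: "\<And>b. b \<in> Basis \<Longrightarrow> l \<bullet> b \<le> u \<bullet> b"
    have le: "l $ i \<le> u $ i" for i
      using lu[of "axis i 1"] by (simp add: inner_axis Basis_vec_range)
    have "p -` box l u = box (p l) (p u)"
      unfolding p_def by (auto simp: mem_box_cart) (metis \<tau>(2))+
    then have "emeasure (distr lborel borel p) (box l u) = emeasure lborel (box (p l) (p u))"
      by (simp add: emeasure_distr)
    also have "\<dots> = (\<Prod>b\<in>Basis. (p u - p l) \<bullet> b)"
      using le by (intro emeasure_lborel_box) (auto simp: Basis_vec_range inner_axis p_def)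
    also have "(\<Prod>b\<in>Basis. (p u - p l) \<bullet> b) = (\<Prod>i\<in>UNIV. (u - l) $ \<tau> i)"
      by (simp add: prod_Basis_vec inner_axis p_def)
    also have "\<dots> = (\<Prod>i\<in>UNIV. (u - l) $ i)"
      using prod.permute[OF \<tau>(1), of "\<lambda>i. (u - l) $ i"] by (simp add: comp_def)
    also have "\<dots> = (\<Prod>b\<in>Basis. (u - l) \<bullet> b)"
      by (simp add: prod_Basis_vec inner_axis)
    finally show "emeasure (distr lborel borel p) (box l u) = (\<Prod>b\<in>Basis. (u - l) \<bullet> b)" .
  qed simp
  then have "(\<integral>\<^sup>+x. F x \<partial>lborel) = (\<integral>\<^sup>+x. F x \<partial>distr lborel borel p)" by simp
  then show ?thesis by (subst (asm) nn_integral_distr) (simp_all add: p_def)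
qed

lemma nn_integral_scale_coordinates:
  fixes F :: "real^'n \<Rightarrow> ennreal"
  assumes F[measurable]: "F \<in> borel_measurable borel" and c: "\<And>i. c i \<noteq> 0"
  shows "(\<integral>\<^sup>+x. F x \<partial>lborel) = ennreal \<bar>\<Prod>i\<in>UNIV. c i\<bar> * (\<integral>\<^sup>+x. F (\<chi> i. c i * x $ i) \<partial>lborel)"
proof -
  define T :: "real^'n \<Rightarrow> real^'n" where "T x = 0 + (\<Sum>j\<in>Basis. (((\<chi> i. c i) \<bullet> j) * (x \<bullet> j)) *\<^sub>R j)" for x
  have T: "T x = (\<chi> i. c i * x $ i)" for x
  proof (rule euclidean_eqI)
    fix b :: "real^'n" assume b: "b \<in> Basis"
    then have "T x \<bullet> b = ((\<chi> i. c i) \<bullet> b) * (x \<bullet> b)"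
      by (simp add: T_def inner_sum_left_Basis)
    then show "T x \<bullet> b = (\<chi> i. c i * x $ i) \<bullet> b"
      using b by (auto simp: Basis_vec_range inner_axis)
  qed
  have [measurable]: "T \<in> borel_measurable borel"
    by (rule borel_measurable_linear) (auto intro!: linearI simp: T vec_eq_iff algebra_simps)
  have "lborel = density (distr lborel borel T) (\<lambda>_. \<Prod>j\<in>Basis. \<bar>(\<chi> i. c i) \<bullet> j\<bar>)"
    unfolding T_def using c by (intro lborel_affine_euclidean) (auto simp: Basis_vec_range inner_axis)
  also have "(\<Prod>j\<in>Basis. \<bar>(\<chi> i. c i) \<bullet> j\<bar>) = \<bar>\<Prod>i\<in>UNIV. c i\<bar>"
    by (simp add: prod_Basis_vec inner_axis abs_prod)
  finally have L: "lborel = density (distr lborel borel T) (\<lambda>_. ennreal \<bar>\<Prod>i\<in>UNIV. c i\<bar>)" .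
  show ?thesis
    by (subst L) (simp add: nn_integral_density nn_integral_distr nn_integral_cmult T[symmetric])
qed

text \<open>
  The formula is multiplicative under composition, because the determinant is. Maps that send
  everything into a coordinate hyperplane also occur as factors in the decomposition; the predicate
  \<open>P\<close> of the proof is vacuous for them.
\<close>
lemma nn_integral_linear_transformation:
  fixes f :: "real^'n \<Rightarrow> real^'n" and F :: "real^'n \<Rightarrow> ennreal"
  assumes lin: "linear f" and d0: "det (matrix f) \<noteq> 0" and F: "F \<in> borel_measurable borel"
  shows "(\<integral>\<^sup>+x. F x \<partial>lborel) = ennreal \<bar>det (matrix f)\<bar> * (\<integral>\<^sup>+y. F (f y) \<partial>lborel)"
proof -
  define P where "P f \<longleftrightarrow> (det (matrix f) \<noteq> 0 \<longrightarrow> (\<forall>F \<in> borel_measurable borel.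
      (\<integral>\<^sup>+x. F x \<partial>lborel) = ennreal \<bar>det (matrix f)\<bar> * (\<integral>\<^sup>+y. F (f y) \<partial>lborel)))"
    for f :: "real^'n \<Rightarrow> real^'n"
  have P_eq: "(\<integral>\<^sup>+x. F x \<partial>lborel) = ennreal \<bar>det (matrix f)\<bar> * (\<integral>\<^sup>+y. F (f y) \<partial>lborel)"
    if "P f" "det (matrix f) \<noteq> 0" "F \<in> borel_measurable borel" for f F
    using that(1)[unfolded P_def] that(2,3) by (rule bspec[OF mp])
  have "P f"
  proof (rule induct_linear_elementary[OF lin])
    fix f g :: "real^'n \<Rightarrow> real^'n"
    assume fg: "linear f" "linear g" and P: "P f" "P g"
    have det: "det (matrix (f \<circ> g)) = det (matrix f) * det (matrix g)"
      using matrix_compose[OF fg(2,1)] by (simp add: det_mul)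
    show "P (f \<circ> g)"
      unfolding P_def
    proof (intro impI ballI)
      fix F :: "real^'n \<Rightarrow> ennreal"
      assume "det (matrix (f \<circ> g)) \<noteq> 0" and F[measurable]: "F \<in> borel_measurable borel"
      then have d: "det (matrix f) \<noteq> 0" "det (matrix g) \<noteq> 0" by (auto simp: det)
      have [measurable]: "f \<in> borel_measurable borel" using fg(1) by (rule borel_measurable_linear)
      have "(\<integral>\<^sup>+x. F x \<partial>lborel) = ennreal \<bar>det (matrix f)\<bar> * (\<integral>\<^sup>+y. F (f y) \<partial>lborel)"
        by (rule P_eq[OF P(1) d(1) F])
      also have "(\<integral>\<^sup>+y. F (f y) \<partial>lborel) = ennreal \<bar>det (matrix g)\<bar> * (\<integral>\<^sup>+y. F (f (g y)) \<partial>lborel)"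
        by (rule P_eq[OF P(2) d(2)]) measurable
      finally show "(\<integral>\<^sup>+x. F x \<partial>lborel) =
          ennreal \<bar>det (matrix (f \<circ> g))\<bar> * (\<integral>\<^sup>+y. F ((f \<circ> g) y) \<partial>lborel)"
        by (simp add: det abs_mult ennreal_mult mult.assoc)
    qed
  next
    fix f :: "real^'n \<Rightarrow> real^'n" and i
    assume f: "linear f" "\<And>x. f x $ i = 0"
    then have "\<not> inj f"
      by (metis linear_injective_imp_surjective one_neq_zero surjE vec_component)
    then show "P f" using det_nz_iff_inj[OF f(1)] by (simp add: P_def)
  next
    fix c :: "'n \<Rightarrow> real"
    have "det (matrix (\<lambda>x::real^'n. \<chi> i. c i * x $ i)) = (\<Prod>i\<in>UNIV. c i)"
      by (simp add: axis_def matrix_def det_diagonal)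
    then show "P (\<lambda>x. \<chi> i. c i * x $ i)"
      using nn_integral_scale_coordinates[of _ c] by (auto simp: P_def)
  next
    fix m n :: 'n assume "m \<noteq> n"
    let ?\<tau> = "Transposition.transpose m n" and ?h = "\<lambda>x::real^'n. \<chi> i. x $ Transposition.transpose m n i"
    have "(\<chi> i j. if ?\<tau> i = j then 1 else 0) = (\<chi> i j. if j = ?\<tau> i then 1 else (0::real))"
      by (auto intro!: Cart_lambda_cong)
    then have "matrix ?h = transpose (\<chi> i j. mat 1 $ i $ ?\<tau> j)"
      by (simp add: transpose_def axis_def mat_def matrix_def)
    then have "\<bar>det (matrix ?h)\<bar> = 1"
      by (simp add: det_permute_columns permutes_swap_id sign_swap_id abs_mult)
    then show "P ?h"
      using nn_integral_permute_coordinates[of _ ?\<tau>] by (simp add: P_def permutes_swap_id)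
  next
    fix m n :: 'n assume mn: "m \<noteq> n"
    let ?h = "\<lambda>x::real^'n. \<chi> i. if i = m then x $ m + x $ n else x $ i"
    have "matrix ?h = (\<chi> k. if k = m then row m (mat 1) + 1 *s row n (mat 1) else row k (mat 1))"
      using mn by (auto simp: vec_eq_iff matrix_def row_def mat_def axis_def)
    then have "det (matrix ?h) = 1"
      by (simp only: det_row_operation[OF mn] det_I)
    moreover have "?h x = x + (x \<bullet> axis n 1) *\<^sub>R axis m 1" for x
    proof -
      have "axis m (1::real) $ i = (if i = m then 1 else 0)" for i by (simp add: axis_def)
      then show ?thesis by (simp add: vec_eq_iff inner_axis)
    qed
    ultimately show "P ?h"
      using mn by (simp add: P_def nn_integral_shear Basis_vec_range axis_eq_axis)
  qed
  then show ?thesis using d0 F by (rule P_eq)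
qed

lemma nn_integral_affine_transformation:
  fixes A :: "real^'n^'n" and c :: "real^'n"
  assumes F[measurable]: "F \<in> borel_measurable borel" and d0: "det A \<noteq> 0"
  shows "(\<integral>\<^sup>+x. F x \<partial>lborel) = ennreal \<bar>det A\<bar> * (\<integral>\<^sup>+y. F (c + y v* A) \<partial>lborel)"
proof -
  have lin: "linear (\<lambda>y. y v* A)"
    using matrix_vector_mul_linear[of "transpose A"] by simp
  have mat: "matrix (\<lambda>y. y v* A) = transpose A"
    using matrix_of_matrix_vector_mul[of "transpose A"] by simp
  have "(\<integral>\<^sup>+x. F x \<partial>lborel) = (\<integral>\<^sup>+x. F x \<partial>distr lborel borel ((+) c))"
    by (simp add: lborel_distr_plus)
  also have "\<dots> = (\<integral>\<^sup>+x. F (c + x) \<partial>lborel)"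
    by (subst nn_integral_distr) simp_all
  also have "\<dots> = ennreal \<bar>det A\<bar> * (\<integral>\<^sup>+y. F (c + y v* A) \<partial>lborel)"
    by (subst nn_integral_linear_transformation[OF lin]) (simp_all add: mat d0)
  finally show ?thesis .
qed

section \<open>Integrating functions of one coordinate and the norm\<close>

lemma sphere_area_factor:
  assumes "m > 0"
  shows "real m * unit_ball_vol (real m) = 2 * pi powr (real m / 2) / Gamma (real m / 2)"
proof -
  have "Gamma (real m / 2 + 1) = real m / 2 * Gamma (real m / 2)"
    using assms by (subst Gamma_plus1) (auto dest: nonpos_Ints_nonpos)
  moreover have "Gamma (real m / 2) > 0"
    using assms by (intro Gamma_real_pos) simp
  ultimately show ?thesis
    unfolding unit_ball_vol_def using assms by (simp only:) (simp add: divide_simps)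
qed

text \<open>
  Polar coordinates, as the law of the radius: the ball of radius \<open>r\<close> in dimension \<open>m\<close> has volume
  \<open>V r\<^sup>m\<close>, so its derivative \<open>m V r\<^sup>m\<^sup>-\<^sup>1\<close> is the density of the radius. Two measures on the line that
  agree on all rays \<open>{..r}\<close>, with finite values there, are equal.
\<close>
lemma distr_product_norm:
  fixes A :: "'i set"
  assumes fin: "finite A" and ne: "A \<noteq> {}"
  shows "distr (Pi\<^sub>M A (\<lambda>_. lborel)) borel (\<lambda>f. sqrt (\<Sum>i\<in>A. (f i)\<^sup>2)) =
    density lborel (\<lambda>r. ennreal (real (card A) * unit_ball_vol (real (card A)) * r ^ (card A - 1))
      * indicator {0..} r)"
    (is "?D = ?E")
proof -
  define m where "m = card A"
  have m: "m > 0" using fin ne by (simp add: m_def card_gt_0_iff)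
  define V where "V = unit_ball_vol (real m)"
  have V: "V \<ge> 0" by (simp add: V_def)
  have D: "emeasure ?D {..r} = ennreal (V * r ^ m)" if "r > 0" for r
  proof -
    have "emeasure ?D {..r} = emeasure (Pi\<^sub>M A (\<lambda>_. lborel))
        ({f. sqrt (\<Sum>i\<in>A. (f i)\<^sup>2) \<le> r} \<inter> space (Pi\<^sub>M A (\<lambda>_. lborel)))"
      by (subst emeasure_distr) (auto simp: vimage_def)
    then show ?thesis using emeasure_cball_aux[OF fin that] by (simp add: V_def m_def)
  qed
  \<comment> \<open>The known volume formula is for positive radii; at \<open>r \<le> 0\<close> the value is squeezed to \<open>0\<close>.\<close>
  have D0: "emeasure ?D {..r} = 0" if "r \<le> 0" for r
  proof -
    have "emeasure ?D {..r} \<le> ennreal (V * (1 / Suc n) ^ m)" for n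
    proof -
      have "r \<le> 1 / real (Suc n)" using that by (rule order_trans) simp
      then have "emeasure ?D {..r} \<le> emeasure ?D {..1 / real (Suc n)}"
        by (intro emeasure_mono) auto
      then show ?thesis by (subst (asm) D) simp_all
    qed
    moreover have "(\<lambda>n. ennreal (V * (1 / Suc n) ^ m)) \<longlonglongrightarrow> ennreal (V * 0 ^ m)"
      by (intro tendsto_ennrealI tendsto_intros LIMSEQ_Suc lim_1_over_n)
    ultimately have "emeasure ?D {..r} \<le> ennreal (V * 0 ^ m)"
      by (intro tendsto_lowerbound[of _ _ sequentially]) auto
    then show ?thesis using m by (simp add: power_0_left)
  qed
  have E: "emeasure ?E {..r} = ennreal (V * r ^ m)" if "r \<ge> 0" for r
  proof -
    have "emeasure ?E {..r} = (\<integral>\<^sup>+x. ennreal (real m * V * x ^ (m - 1)) * indicator {0..r} x \<partial>lborel)"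
      by (subst emeasure_density)
        (auto intro!: nn_integral_cong simp: V_def m_def split: split_indicator)
    also have "\<dots> = ennreal (V * r ^ m - V * 0 ^ m)"
      using V that
      by (intro nn_integral_FTC_Icc) (auto intro!: derivative_eq_intros)
    finally show ?thesis using m by (simp add: power_0_left)
  qed
  have E0: "emeasure ?E {..r} = 0" if "r < 0" for r
  proof -
    have "emeasure ?E {..r} \<le> emeasure ?E {..0}" using that by (intro emeasure_mono) auto
    then show ?thesis using E[of 0] m by (simp add: power_0_left)
  qed
  show ?thesis
  proof (rule measure_eqI_generator_eq[where \<Omega> = UNIV and E = "range atMost" and A = "\<lambda>n. {..real n}"])
    show "Int_stable (range atMost :: real set set)"
      by (force simp: Int_stable_def)
    show "sets ?D = sigma_sets UNIV (range atMost)" "sets ?E = sigma_sets UNIV (range atMost)"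
      by (simp_all add: borel_eq_atMost)
    show "(\<Union>n. {..real n}) = UNIV"
      by (auto intro: real_arch_simple)
    fix X :: "real set" assume "X \<in> range atMost"
    then obtain r where "X = {..r}" by auto
    then show "emeasure ?D X = emeasure ?E X"
      using D[of r] D0[of r] E[of r] E0[of r] m by (cases r "0::real" rule: linorder_cases) (auto simp: power_0_left)
  next
    fix n
    have "emeasure ?D {..real n} < \<infinity>"
      using D[of "real n"] D0[of "real n"] by (cases "n = 0") auto
    then show "emeasure ?D {..real n} \<noteq> \<infinity>" by simp
  qed auto
qed

text \<open>
  The product structure of Lebesgue measure splits off the coordinate along \<open>e\<close>. The other coordinates
  enter only through their norm \<open>r\<close>, whose law is the one computed above; in dimension two it is
  twice Lebesgue measure on the half-line, since the unit sphere of the line has two points.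
\<close>
lemma nn_integral_coordinate_norm:
  fixes e :: "'a::euclidean_space" and F :: "real \<Rightarrow> real \<Rightarrow> ennreal"
  assumes e: "e \<in> Basis" and dim: "DIM('a) \<ge> 2"
    and F[measurable]: "case_prod F \<in> borel_measurable (borel \<Otimes>\<^sub>M borel)"
  shows "(\<integral>\<^sup>+(y::'a). F (y \<bullet> e) (y \<bullet> y) \<partial>lborel) =
    (\<integral>\<^sup>+z. \<integral>\<^sup>+r. ennreal (2 * pi powr ((real DIM('a) - 1) / 2) / Gamma ((real DIM('a) - 1) / 2) * r ^ (DIM('a) - 2))
       * indicator {0..} r * F z (z\<^sup>2 + r\<^sup>2) \<partial>lborel \<partial>lborel)"
proof -
  interpret product_sigma_finite "\<lambda>_::'a. lborel :: real measure" by standard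
  define B where "B = Basis - {e}"
  have B: "finite B" "e \<notin> B" "Basis = insert e B" using e by (auto simp: B_def)
  have cB: "card B = DIM('a) - 1" using e by (simp add: B_def)
  then have "B \<noteq> {}" using dim by auto
  have m: "card B > 0" using cB dim by simp
  have sum_e: "(\<Sum>b\<in>Basis. x b *\<^sub>R b) \<bullet> e = x e" for x
    using e by (simp add: inner_sum_left_Basis)
  have sum_n: "(\<Sum>b\<in>Basis. x b *\<^sub>R b) \<bullet> (\<Sum>b\<in>Basis. x b *\<^sub>R b) = (x e)\<^sup>2 + (\<Sum>b\<in>B. (x b)\<^sup>2)" for x :: "'a \<Rightarrow> real"
  proof -
    have "(\<Sum>b\<in>Basis. x b *\<^sub>R b) \<bullet> (\<Sum>b\<in>Basis. x b *\<^sub>R b) = (\<Sum>b\<in>Basis. (x b)\<^sup>2)"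
      by (subst euclidean_inner) (simp add: inner_sum_left_Basis power2_eq_square)
    also have "\<dots> = (x e)\<^sup>2 + (\<Sum>b\<in>B. (x b)\<^sup>2)"
      unfolding B(3) using B(1,2) by (rule sum.insert)
    finally show ?thesis .
  qed
  have [measurable]: "(\<lambda>x. \<Sum>b\<in>B. (x b :: real)\<^sup>2) \<in> borel_measurable (Pi\<^sub>M (insert e B) (\<lambda>_. lborel))"
  proof (rule borel_measurable_sum)
    fix b assume "b \<in> B"
    then have "(\<lambda>x. x b :: real) \<in> borel_measurable (Pi\<^sub>M (insert e B) (\<lambda>_. lborel))"
      using measurable_component_singleton[of b "insert e B" "\<lambda>_. lborel :: real measure"] by simp
    then show "(\<lambda>x. (x b)\<^sup>2) \<in> borel_measurable (Pi\<^sub>M (insert e B) (\<lambda>_. lborel :: real measure))"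
      by (rule borel_measurable_power)
  qed
  have meas: "(\<lambda>x. F (x e) ((x e)\<^sup>2 + (\<Sum>b\<in>B. (x b)\<^sup>2))) \<in> borel_measurable (Pi\<^sub>M (insert e B) (\<lambda>_. lborel))"
    by measurable
  have "(\<integral>\<^sup>+(y::'a). F (y \<bullet> e) (y \<bullet> y) \<partial>lborel) =
      (\<integral>\<^sup>+x. F (x e) ((x e)\<^sup>2 + (\<Sum>b\<in>B. (x b)\<^sup>2)) \<partial>Pi\<^sub>M (insert e B) (\<lambda>_. lborel))"
    by (subst lborel_eq, subst nn_integral_distr) (simp_all add: sum_e sum_n B(3)[symmetric])
  also have "\<dots> = (\<integral>\<^sup>+z. \<integral>\<^sup>+x. F z (z\<^sup>2 + (\<Sum>b\<in>B. (x b)\<^sup>2)) \<partial>Pi\<^sub>M B (\<lambda>_. lborel) \<partial>lborel)"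
  proof (subst product_nn_integral_insert_rev)
    have "(\<Sum>b\<in>B. ((x(e := z)) b)\<^sup>2) = (\<Sum>b\<in>B. (x b)\<^sup>2)" for x :: "'a \<Rightarrow> real" and z
      using B by (intro sum.cong) auto
    then show "(\<integral>\<^sup>+z. \<integral>\<^sup>+x. F ((x(e := z)) e) (((x(e := z)) e)\<^sup>2 + (\<Sum>b\<in>B. ((x(e := z)) b)\<^sup>2)) \<partial>Pi\<^sub>M B (\<lambda>_. lborel) \<partial>lborel)
      = (\<integral>\<^sup>+z. \<integral>\<^sup>+x. F z (z\<^sup>2 + (\<Sum>b\<in>B. (x b)\<^sup>2)) \<partial>Pi\<^sub>M B (\<lambda>_. lborel) \<partial>lborel)"
      by simp
  qed (use B(1,2) meas in simp_all)
  also have "\<dots> = (\<integral>\<^sup>+z. \<integral>\<^sup>+r. F z (z\<^sup>2 + r\<^sup>2)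
      \<partial>distr (Pi\<^sub>M B (\<lambda>_. lborel)) borel (\<lambda>f. sqrt (\<Sum>b\<in>B. (f b)\<^sup>2)) \<partial>lborel)"
    by (intro nn_integral_cong, subst nn_integral_distr) (simp_all add: sum_nonneg)
  also have "\<dots> = (\<integral>\<^sup>+z. \<integral>\<^sup>+r. ennreal (real (card B) * unit_ball_vol (real (card B)) * r ^ (card B - 1))
      * indicator {0..} r * F z (z\<^sup>2 + r\<^sup>2) \<partial>lborel \<partial>lborel)"
    unfolding distr_product_norm[OF \<open>finite B\<close> \<open>B \<noteq> {}\<close>]
    by (intro nn_integral_cong, subst nn_integral_density) simp_all
  also have "real (card B) * unit_ball_vol (real (card B))
      = 2 * pi powr ((real DIM('a) - 1) / 2) / Gamma ((real DIM('a) - 1) / 2)"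
    using sphere_area_factor[OF m] dim by (simp add: cB of_nat_diff)
  also have "card B - 1 = DIM('a) - 2"
    using cB by simp
  finally show ?thesis .
qed

section \<open>The law of the standardized portfolio\<close>

text \<open>
  The density of one coordinate of a vector with density \<open>g(\<bar>y\<bar>\<^sup>2)\<close>. Its values are
  extended nonnegative reals because the radial integral is a priori finite only for almost every \<open>z\<close>.
\<close>
definition marginal_density :: "(real \<Rightarrow> real) \<Rightarrow> nat \<Rightarrow> real \<Rightarrow> ennreal" where
  "marginal_density g n z =
    (\<integral>\<^sup>+r. ennreal (2 * pi powr ((real n - 1) / 2) / Gamma ((real n - 1) / 2) * r ^ (n - 2))
       * indicator {0..} r * ennreal (g (z\<^sup>2 + r\<^sup>2)) \<partial>lborel)"

lemma measurable_marginal_density [measurable]: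
  assumes [measurable]: "g \<in> borel_measurable borel"
  shows "marginal_density g n \<in> borel_measurable borel"
  unfolding marginal_density_def by measurable

lemma marginal_density_pos:
  assumes [measurable]: "g \<in> borel_measurable borel"
    and pos: "\<And>t. t \<ge> 0 \<Longrightarrow> g t > 0" and n: "n \<ge> 2"
  shows "marginal_density g n z > 0"
proof (rule ccontr)
  define c where "c = 2 * pi powr ((real n - 1) / 2) / Gamma ((real n - 1) / 2)"
  have c: "c > 0" using n by (auto simp: c_def intro!: divide_pos_pos Gamma_real_pos)
  assume "\<not> marginal_density g n z > 0"
  then have "(\<integral>\<^sup>+r. ennreal (c * r ^ (n - 2)) * indicator {0..} r * ennreal (g (z\<^sup>2 + r\<^sup>2)) \<partial>lborel) = 0"
    by (simp add: marginal_density_def c_def)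
  then have "AE r in lborel. ennreal (c * r ^ (n - 2)) * indicator {0..} r * ennreal (g (z\<^sup>2 + r\<^sup>2)) = 0"
    by (subst (asm) nn_integral_0_iff_AE) auto
  then have "AE r in lborel. r \<notin> {1..2::real}"
  proof (rule AE_mp, intro AE_I2 impI notI)
    fix r :: real
    assume 0: "ennreal (c * r ^ (n - 2)) * indicator {0..} r * ennreal (g (z\<^sup>2 + r\<^sup>2)) = 0"
      and r: "r \<in> {1..2}"
    have "c * r ^ (n - 2) > 0" "g (z\<^sup>2 + r\<^sup>2) > 0"
      using c r by (auto intro!: pos mult_pos_pos)
    then show False using 0 r by (auto simp: ennreal_eq_0_iff)
  qed
  then have "emeasure lborel {1..2::real} = 0"
    by (subst (asm) AE_iff_measurable[of "{1..2::real}"]) auto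
  then show False by simp
qed

text \<open>
  The substitution \<open>x = \<mu> + y A\<close> turns the standardized portfolio into the coordinate \<open>y\<^sub>k\<close>, for an
  arbitrary fixed index \<open>k\<close>, and makes the density rotationally symmetric.
\<close>
lemma distr_standardized_portfolio:
  fixes X :: "'a \<Rightarrow> real^'n"
  assumes sym: "symmetric_matrix S" and pos: "positive_definite S" and "\<delta> \<noteq> 0"
    and n: "CARD('n) \<ge> 2"
    and h[measurable]: "h \<in> borel_measurable borel"
    and X: "distributed M lborel X (\<lambda>x. ennreal (elliptic_density h \<mu> S x))"
  shows "distr M borel (\<lambda>\<omega>. (\<delta> \<bullet> X \<omega> - \<delta> \<bullet> \<mu>) / sqrt ((\<delta> v* S) \<bullet> \<delta>)) =
    density lborel (marginal_density h CARD('n))"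
proof (rule measure_eqI)
  define \<sigma> where "\<sigma> = sqrt ((\<delta> v* S) \<bullet> \<delta>)"
  have \<sigma>: "\<sigma> > 0" using pos \<open>\<delta> \<noteq> 0\<close> by (simp add: \<sigma>_def positive_definite_def)
  define T where "T x = (\<delta> \<bullet> x - \<delta> \<bullet> \<mu>) / \<sigma>" for x :: "real^'n"
  have T[measurable]: "T \<in> borel_measurable borel"
    unfolding T_def by (intro borel_measurable_continuous_onI continuous_intros) (use \<sigma> in auto)
  have Xm[measurable]: "X \<in> measurable M borel"
    using distributed_measurable[OF X] by simp
  have f[measurable]: "(\<lambda>x. ennreal (elliptic_density h \<mu> S x)) \<in> borel_measurable borel"
    using distributed_borel_measurable[OF X] by simp
  \<comment> \<open>Rotational symmetry makes all coordinates equivalent, so any index serves.\<close>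
  define k :: 'n where "k = undefined"
  obtain A :: "real^'n^'n"
    where A: "\<And>y. ((y v* A) v* matrix_inv S) \<bullet> (y v* A) = y \<bullet> y"
    and dA: "\<And>y. \<delta> \<bullet> (y v* A) = \<sigma> * y $ k"
    and det: "det A ^ 2 = det S" "det A \<noteq> 0"
    unfolding \<sigma>_def using elliptic_standardizing_matrix[OF sym pos \<open>\<delta> \<noteq> 0\<close>, of k] by blast
  have norm: "\<bar>det A\<bar> * det S powr (-1/2) = 1"
  proof -
    have "det S powr (-1/2) = inverse (sqrt (det S))"
      using det(1) by (simp add: powr_minus powr_half_sqrt flip: det(1))
    also have "sqrt (det S) = \<bar>det A\<bar>" by (simp flip: det(1))
    finally show ?thesis using det(2) by simp
  qed
  fix B assume "B \<in> sets (distr M borel (\<lambda>\<omega>. (\<delta> \<bullet> X \<omega> - \<delta> \<bullet> \<mu>) / sqrt ((\<delta> v* S) \<bullet> \<delta>)))"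
  then have B[measurable]: "B \<in> sets borel" by simp
  have "emeasure (distr M borel (\<lambda>\<omega>. (\<delta> \<bullet> X \<omega> - \<delta> \<bullet> \<mu>) / sqrt ((\<delta> v* S) \<bullet> \<delta>))) B
      = emeasure (distr M borel (T \<circ> X)) B"
    by (simp add: T_def \<sigma>_def comp_def)
  also have "\<dots> = emeasure (distr (distr M lborel X) borel T) B"
    by (subst distr_distr) simp_all
  also have "\<dots> = (\<integral>\<^sup>+x. ennreal (elliptic_density h \<mu> S x) * indicator B (T x) \<partial>lborel)"
    unfolding distributed_distr_eq_density[OF X]
    by (subst emeasure_distr, simp, simp, subst emeasure_density)
      (auto intro!: nn_integral_cong measurable_sets_borel[OF T] split: split_indicator)
  also have "\<dots> = ennreal \<bar>det A\<bar> *
      (\<integral>\<^sup>+y. ennreal (elliptic_density h \<mu> S (\<mu> + y v* A)) * indicator B (T (\<mu> + y v* A)) \<partial>lborel)"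
    by (rule nn_integral_affine_transformation) (simp_all add: det)
  also have "\<dots> = ennreal \<bar>det A\<bar> * (\<integral>\<^sup>+y. ennreal (det S powr (-1/2)) *
      (ennreal (h (y \<bullet> y)) * indicator B (y $ k)) \<partial>lborel)"
    using \<sigma> by (simp add: T_def elliptic_density_def A dA inner_add_right ennreal_mult' mult.assoc)
  also have "\<dots> = (\<integral>\<^sup>+(y::real^'n). ennreal (h (y \<bullet> y)) * indicator B (y $ k) \<partial>lborel)"
    using norm by (subst nn_integral_cmult) (simp_all flip: mult.assoc ennreal_mult)
  also have "\<dots> = (\<integral>\<^sup>+(y::real^'n). ennreal (h (y \<bullet> y)) * indicator B (y \<bullet> axis k 1) \<partial>lborel)"
    by (simp add: inner_axis)
  also have "\<dots> = (\<integral>\<^sup>+z. \<integral>\<^sup>+r. ennreal (2 * pi powr ((real CARD('n) - 1) / 2) / Gamma ((real CARD('n) - 1) / 2) * r ^ (CARD('n) - 2))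
       * indicator {0..} r * (ennreal (h (z\<^sup>2 + r\<^sup>2)) * indicator B z) \<partial>lborel \<partial>lborel)"
    using nn_integral_coordinate_norm[of "axis k 1 :: real^'n" "\<lambda>z t. ennreal (h t) * indicator B z"] n
    by simp
  also have "\<dots> = (\<integral>\<^sup>+z. marginal_density h CARD('n) z * indicator B z \<partial>lborel)"
    unfolding marginal_density_def by (subst nn_integral_multc[symmetric]) (simp_all add: mult.assoc)
  also have "\<dots> = emeasure (density lborel (marginal_density h CARD('n))) B"
    by (subst emeasure_density) simp_all
  finally show "emeasure (distr M borel (\<lambda>\<omega>. (\<delta> \<bullet> X \<omega> - \<delta> \<bullet> \<mu>) / sqrt ((\<delta> v* S) \<bullet> \<delta>))) B
      = emeasure (density lborel (marginal_density h CARD('n))) B" .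
qed simp

section \<open>Tail function and quantiles\<close>

text \<open>
  The real-valued inner integral of the tail function is \<open>0\<close> where the radial integral diverges. The
  total mass of the marginal density is \<open>1\<close>, so this happens only on a null set and does not change the
  outer integral.
\<close>
lemma tail_function_eq_cdf:
  assumes h[measurable]: "h \<in> borel_measurable borel"
    and nonneg: "\<And>t. t \<ge> 0 \<Longrightarrow> h t \<ge> 0" and n: "n \<ge> 2"
    and prob: "prob_space (density lborel (marginal_density h n))"
  shows "tail_function h n s = cdf (density lborel (marginal_density h n)) (- s)"
proof -
  define c where "c = 2 * pi powr ((real n - 1) / 2) / Gamma ((real n - 1) / 2)"
  have c: "c > 0" using n by (auto simp: c_def intro!: divide_pos_pos Gamma_real_pos)
  define J where "J z = (\<integral>\<^sup>+r. ennreal (indicator {0..} r * (r ^ (n - 2) * h (z\<^sup>2 + r\<^sup>2))) \<partial>lborel)" for z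
  have J[measurable]: "J \<in> borel_measurable borel" unfolding J_def by measurable
  have marg: "marginal_density h n z = ennreal c * J z" for z
  proof -
    have "ennreal c * J z =
        (\<integral>\<^sup>+r. ennreal c * ennreal (indicator {0..} r * (r ^ (n - 2) * h (z\<^sup>2 + r\<^sup>2))) \<partial>lborel)"
      unfolding J_def by (rule nn_integral_cmult[symmetric]) measurable
    also have "\<dots> = marginal_density h n z"
      unfolding marginal_density_def c_def[symmetric]
    proof (rule nn_integral_cong)
      fix r :: real
      show "ennreal c * ennreal (indicator {0..} r * (r ^ (n - 2) * h (z\<^sup>2 + r\<^sup>2))) =
          ennreal (c * r ^ (n - 2)) * indicator {0..} r * ennreal (h (z\<^sup>2 + r\<^sup>2))"
        using c nonneg[of "z\<^sup>2 + r\<^sup>2"] by (cases "r \<ge> 0") (simp_all add: mult.assoc flip: ennreal_mult)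
    qed
    finally show ?thesis by simp
  qed
  have "(\<integral>\<^sup>+z. marginal_density h n z \<partial>lborel) = 1"
    using prob_space.emeasure_space_1[OF prob] by (simp add: emeasure_density)
  then have "AE z in lborel. marginal_density h n z \<noteq> \<infinity>"
    by (intro nn_integral_PInf_AE) auto
  then have Jfin: "AE z in lborel. J z < \<infinity>"
    by (rule eventually_mono) (use c in \<open>auto simp: marg ennreal_mult_eq_top_iff less_top\<close>)
  have inner: "(LBINT r:{0..}. r ^ (n - 2) * h (z\<^sup>2 + r\<^sup>2)) = enn2real (J z)" for z
    unfolding set_lebesgue_integral_def J_def
    by (subst integral_eq_nn_integral) (use nonneg in \<open>auto split: split_indicator\<close>)
  have "(LBINT z:{..-s}. enn2real (J z)) =
      enn2real (\<integral>\<^sup>+z. ennreal (indicator {..-s} z * enn2real (J z)) \<partial>lborel)"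
    unfolding set_lebesgue_integral_def
    by (subst integral_eq_nn_integral) auto
  also have "(\<integral>\<^sup>+z. ennreal (indicator {..-s} z * enn2real (J z)) \<partial>lborel) =
      (\<integral>\<^sup>+z. J z * indicator {..-s} z \<partial>lborel)"
    using Jfin by (intro nn_integral_cong_AE, eventually_elim) (auto split: split_indicator)
  finally have "tail_function h n s = enn2real (ennreal c * (\<integral>\<^sup>+z. J z * indicator {..-s} z \<partial>lborel))"
    using c unfolding tail_function_def inner c_def[symmetric] by (simp add: enn2real_mult)
  also have "\<dots> = cdf (density lborel (marginal_density h n)) (- s)"
    unfolding cdf_def measure_def
    by (subst emeasure_density, simp, simp, subst nn_integral_cmult[symmetric])
      (simp_all add: marg[abs_def] mult.assoc)
  finally show ?thesis .
qed

text \<open>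
  Having a density excludes atoms, so the distribution function is continuous and the open and closed
  half-lines have equal mass. Positivity of the density makes every nondegenerate interval charged, so
  the distribution function is strictly increasing. Existence is the intermediate value theorem.
\<close>
lemma positive_density_unique_quantile:
  fixes \<phi> :: "real \<Rightarrow> ennreal"
  assumes \<phi>[measurable]: "\<phi> \<in> borel_measurable borel" and pos: "\<And>z. \<phi> z > 0"
    and prob: "prob_space (density lborel \<phi>)" and \<alpha>: "0 < \<alpha>" "\<alpha> < 1"
  shows "\<exists>!x. cdf (density lborel \<phi>) x = \<alpha>"
    and "measure (density lborel \<phi>) {..<x} = cdf (density lborel \<phi>) x"
proof -
  let ?N = "density lborel \<phi>"
  interpret prob_space ?N by (fact prob)
  interpret real_distribution ?N by standard simp
  have atom: "measure ?N {x} = 0" for x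
  proof -
    have "AE z in lborel. \<phi> z * indicator {x} z = 0"
      using AE_lborel_singleton[of x] by eventually_elim simp
    then have "(\<integral>\<^sup>+z. \<phi> z * indicator {x} z \<partial>lborel) = 0"
      by (subst nn_integral_0_iff_AE) simp_all
    then show ?thesis by (simp add: measure_def emeasure_density)
  qed
  have cont: "isCont (cdf ?N) x" for x
    by (simp add: isCont_cdf atom)
  have mono: "cdf ?N x < cdf ?N y" if "x < y" for x y
  proof (rule ccontr)
    assume "\<not> cdf ?N x < cdf ?N y"
    then have "measure ?N {x<..y} = 0"
      using cdf_diff_eq[OF that] measure_nonneg[of ?N "{x<..y}"] by linarith
    then have "(\<integral>\<^sup>+z. \<phi> z * indicator {x<..y} z \<partial>lborel) = 0"
      by (simp add: emeasure_eq_measure flip: emeasure_density)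
    then have "AE z in lborel. z \<notin> {x<..y}"
    proof -
      assume "(\<integral>\<^sup>+z. \<phi> z * indicator {x<..y} z \<partial>lborel) = 0"
      then have "AE z in lborel. \<phi> z * indicator {x<..y} z = 0"
        by (subst (asm) nn_integral_0_iff_AE) simp_all
      then show ?thesis
      proof (rule AE_mp, intro AE_I2 impI notI)
        fix z assume "\<phi> z * indicator {x<..y} z = 0" "z \<in> {x<..y}"
        then show False using pos[of z] by simp
      qed
    qed
    then have "emeasure lborel {x<..y} = 0"
      by (subst (asm) AE_iff_measurable[of "{x<..y}"]) auto
    then show False using that by simp
  qed
  show "measure ?N {..<x} = cdf ?N x"
  proof -
    have "cdf ?N x = measure ?N ({..<x} \<union> {x})"
      by (simp only: cdf_def2 ivl_disj_un)
    also have "\<dots> = measure ?N {..<x} + measure ?N {x}"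
      by (intro finite_measure_Union) auto
    finally show ?thesis by (simp add: atom)
  qed
  have "eventually (\<lambda>x. cdf ?N x < \<alpha>) at_bot"
    using order_tendstoD(2)[OF cdf_lim_at_bot \<alpha>(1)] .
  then obtain a where a: "cdf ?N a < \<alpha>"
    by (auto simp: eventually_at_bot_linorder)
  have "eventually (\<lambda>x. \<alpha> < cdf ?N x) at_top"
    using order_tendstoD(1)[OF cdf_lim_at_top_prob \<alpha>(2)] .
  then obtain b where b: "\<alpha> < cdf ?N b"
    by (auto simp: eventually_at_top_linorder)
  have "a \<le> b"
    using a b mono[of b a] by (cases "b < a") auto
  then obtain x where x: "cdf ?N x = \<alpha>"
    using IVT[of "cdf ?N" a \<alpha> b] a b cont by (meson less_imp_le)
  show "\<exists>!x. cdf ?N x = \<alpha>"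
  proof (rule ex1I)
    show "cdf ?N x = \<alpha>" by (fact x)
    fix y assume "cdf ?N y = \<alpha>"
    then show "y = x" using mono[of x y] mono[of y x] x by (cases x y rule: linorder_cases) auto
  qed
qed

theorem theorem2p1:
  fixes M :: "'a measure"
    and X :: "'a \<Rightarrow> real^'n"
    and \<mu> \<delta> :: "real^'n"
    and S :: "real^'n^'n"
    and g :: "real \<Rightarrow> real"
    and \<alpha> :: real
    and P :: "'a \<Rightarrow> real"
  assumes "CARD('n) \<ge> 2"
    and "symmetric_matrix S" and "positive_definite S"
    and "\<delta> \<noteq> 0"
    and "\<And>t. t \<ge> 0 \<Longrightarrow> g t \<ge> 0"
    and "continuous_on {0..} g"
    and "\<And>t. t \<ge> 0 \<Longrightarrow> g t \<noteq> 0"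
    and "integrable lborel (\<lambda>s. g (s\<^sup>2))"
    and "prob_space M"
    and "distributed M lborel X (\<lambda>x. ennreal (elliptic_density g \<mu> S x))"
    and "\<And>\<omega>. P \<omega> = (\<Sum>i\<in>UNIV. \<delta> $ i * X \<omega> $ i)"
    and "0 < \<alpha>" and "\<alpha> < 1"
  shows "(\<exists>!s. \<alpha> = tail_function g CARD('n) s) \<and>
    (\<exists>!v. is_value_at_risk M P \<alpha> v) \<and>
    value_at_risk M P \<alpha> =
      - (\<delta> \<bullet> \<mu>) + elliptic_quantile \<alpha> CARD('n) g * sqrt ((\<delta> v* S) \<bullet> \<delta>)"
proof -
  \<comment> \<open>Constant to the left of \<open>0\<close>, so that \<open>h\<close> is continuous and hence measurable on the whole line.\<close>
  define h where "h t = g (max 0 t)" for t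
  have hg: "h t = g t" if "t \<ge> 0" for t using that by (simp add: h_def)
  have "continuous_on UNIV h"
    unfolding h_def by (intro continuous_on_compose2[OF assms(6)] continuous_intros) auto
  then have h[measurable]: "h \<in> borel_measurable borel" by (rule borel_measurable_continuous_onI)
  have hpos: "h t > 0" if "t \<ge> 0" for t
    using assms(5,7)[OF that] by (simp add: hg that less_le)
  have tail: "tail_function g CARD('n) = tail_function h CARD('n)"
    by (simp add: tail_function_def h_def fun_eq_iff)
  have "(x v* matrix_inv S) \<bullet> x \<ge> 0" for x
    using inverse_of_positive_definite(4)[OF assms(2,3)]
    by (cases "x = 0") (auto simp: positive_definite_def less_imp_le)
  then have dens: "elliptic_density g \<mu> S = elliptic_density h \<mu> S"
    by (simp add: elliptic_density_def hg fun_eq_iff)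
  define \<sigma> where "\<sigma> = sqrt ((\<delta> v* S) \<bullet> \<delta>)"
  have \<sigma>: "\<sigma> > 0" using assms(3,4) by (simp add: \<sigma>_def positive_definite_def)
  define Z where "Z \<omega> = (\<delta> \<bullet> X \<omega> - \<delta> \<bullet> \<mu>) / \<sigma>" for \<omega>
  define N where "N = density lborel (marginal_density h CARD('n))"
  have X: "X \<in> borel_measurable M" using distributed_measurable[OF assms(10)] by simp
  then have Z: "Z \<in> borel_measurable M"
    unfolding Z_def using \<sigma> by (intro borel_measurable_divide borel_measurable_diff borel_measurable_inner) auto
  have N: "distr M borel Z = N"
    unfolding Z_def[abs_def] N_def \<sigma>_def
    by (rule distr_standardized_portfolio) (use assms dens in auto)
  have prob: "prob_space (density lborel (marginal_density h CARD('n)))"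
    using prob_space.prob_space_distr[OF assms(9) Z] N by (simp add: N_def)
  have \<phi>: "marginal_density h CARD('n) z > 0" for z
    using hpos assms(1) by (intro marginal_density_pos) auto
  have tail_cdf: "tail_function g CARD('n) s = cdf N (- s)" for s
    unfolding tail N_def using hpos assms(1)
    by (intro tail_function_eq_cdf prob) (auto intro: less_imp_le)
  obtain x where x: "\<And>y. cdf N y = \<alpha> \<longleftrightarrow> y = x"
    using positive_density_unique_quantile(1)[OF _ \<phi> prob assms(12,13)] unfolding N_def by auto
  have q: "\<alpha> = tail_function g CARD('n) s \<longleftrightarrow> s = - x" for s
    using x[of "- s"] by (auto simp: tail_cdf)
  have P: "P \<omega> = \<delta> \<bullet> X \<omega>" for \<omega>
    by (simp add: assms(11) inner_vec_def)
  \<comment> \<open>\<open>P < -v\<close> is the event \<open>Z < y\<close> with \<open>y\<close> the standardized threshold, and \<open>y\<close> must be the quantile \<open>x\<close>.\<close>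
  have var: "is_value_at_risk M P \<alpha> v \<longleftrightarrow> v = - (\<delta> \<bullet> \<mu>) - x * \<sigma>" for v
  proof -
    define y where "y = (- v - \<delta> \<bullet> \<mu>) / \<sigma>"
    have "{\<omega> \<in> space M. P \<omega> < - v} = Z -` {..<y} \<inter> space M"
      using \<sigma> by (auto simp: P Z_def y_def divide_strict_right_mono field_simps)
    then have "measure M {\<omega> \<in> space M. P \<omega> < - v} = measure N {..<y}"
      using Z by (simp add: measure_distr flip: N)
    also have "\<dots> = cdf N y"
      unfolding N_def by (rule positive_density_unique_quantile(2)[OF _ \<phi> prob assms(12,13)]) simp
    finally have "is_value_at_risk M P \<alpha> v \<longleftrightarrow> y = x"
      by (simp add: is_value_at_risk_def x)
    also have "\<dots> \<longleftrightarrow> v = - (\<delta> \<bullet> \<mu>) - x * \<sigma>"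
      using \<sigma> by (auto simp: y_def field_simps)
    finally show ?thesis .
  qed
  show ?thesis
    by (simp add: elliptic_quantile_def value_at_risk_def q var flip: \<sigma>_def)
qed

end
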